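(* Let $\Phi$, $\varphi$, $V$ be as in the standing assumption (see context), and suppose that $\varphi\in\mathcal Z(\mathbb R^d)$ is radially symmetric. Furthermore, assume there exists a hyperplane $\pi\ni0$ such that $\varphi(Px)=\varphi(x)$ for all $x\in\mathbb R^d$, where $P$ denotes reflection with respect to $\pi$. Then $V(Px)=V(x)$ for all $x\in\mathbb R^d$.
   Context: Notation: $B_r(a)$ is the open ball in $\mathbb R^d$; $D_hf(x)=f(x+h)-2f(x)+f(x-h)$. $\Phi$ is a complete Bernstein function with Lévy pair $(0,\mu)$: $\Phi(u)=\int_0^\infty(1-e^{-ut})\mu(t)\,dt$ with $\mu:(0,\infty)\to[0,\infty)$ completely monotone and $\int_0^\infty\min(1,t)\mu(t)\,dt<\infty$. The jump kernel is $j(r)=(4\pi)^{-d/2}\int_0^\infty t^{-d/2}e^{-r^2/(4t)}\mu(t)\,dt$, $r>0$. $\Phi(-\Delta)$ is the operator on $L^2(\mathbb R^d)$ with Fourier multiplier $\Phi(|y|^2)$. Standing assumption: $V:\mathbb R^d\to\mathbb R$ is a potential, $H=\Phi(-\Delta)+V$, and $\varphi\in L^2(\mathbb R^d)\cap L^\infty(\mathbb R^d)$, $\varphi>0$, satisfies $H\varphi=0$. The potential is understood through the pointwise expression $V(x)=-\frac{1}{\varphi(x)}\Phi(-\Delta)\varphi(x)=\frac{1}{2\varphi(x)}\int_{\mathbb R^d}D_h\varphi(x)\,j(|h|)\,dh$. Space: $\mathcal Z(\mathbb R^d)$ is the set of $f\in L^\infty(\mathbb R^d)$ for which there exist functions $L_f,R_f:\mathbb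 R^d\to(0,\infty)$ such that $|D_hf(x)|\le L_f(x)|h|^2$ for all $x\in\mathbb R^d$ and $h\in B_{R_f(x)}(0)$. *)

theory Defs
  imports "HOL-Analysis.Analysis"
begin

section \<open>Complete Bernstein functions and their jump kernels\<close>

definition completely_monotone :: "(real \<Rightarrow> real) \<Rightarrow> bool" where
  "completely_monotone \<mu> \<longleftrightarrow>
     (\<forall>n. \<forall>t>0. (deriv ^^ n) \<mu> differentiable at t \<and> (-1) ^ n * (deriv ^^ n) \<mu> t \<ge> 0)"

text \<open>\<open>complete_bernstein \<Phi> \<mu>\<close>: \<open>\<Phi>\<close> is the complete Bernstein function with Levy pair \<open>(0, \<mu>)\<close>.
  Only the values of \<open>\<mu>\<close> and \<open>\<Phi>\<close> on \<open>(0, \<infinity>)\<close> matter.\<close>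

definition complete_bernstein :: "(real \<Rightarrow> real) \<Rightarrow> (real \<Rightarrow> real) \<Rightarrow> bool" where
  "complete_bernstein \<Phi> \<mu> \<longleftrightarrow>
     completely_monotone \<mu> \<and>
     set_integrable lborel {0<..} (\<lambda>t. min 1 t * \<mu> t) \<and>
     (\<forall>u>0. \<Phi> u = (LINT t:{0<..}|lborel. (1 - exp (- (u * t))) * \<mu> t))"

definition jump_kernel :: "nat \<Rightarrow> (real \<Rightarrow> real) \<Rightarrow> real \<Rightarrow> real" where
  "jump_kernel d \<mu> r = (4 * pi) powr (- real d / 2) *
     (LINT t:{0<..}|lborel. t powr (- real d / 2) * exp (- r\<^sup>2 / (4 * t)) * \<mu> t)"

section \<open>Function spaces\<close>

text \<open>Elements of \<open>L\<^sup>2\<close> and \<open>L\<^sup>\<infinity>\<close> are represented by Lebesgue measurable functions.\<close>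

definition square_integrable :: "(real ^ 'n \<Rightarrow> 'b::real_normed_vector) \<Rightarrow> bool" where
  "square_integrable f \<longleftrightarrow>
     f \<in> borel_measurable lebesgue \<and> integrable lebesgue (\<lambda>x. (norm (f x))\<^sup>2)"

definition ess_bounded :: "(real ^ 'n \<Rightarrow> real) \<Rightarrow> bool" where
  "ess_bounded f \<longleftrightarrow>
     f \<in> borel_measurable lebesgue \<and> (\<exists>C. AE x in lebesgue. \<bar>f x\<bar> \<le> C)"

definition second_diff :: "'a::real_vector \<Rightarrow> ('a \<Rightarrow> real) \<Rightarrow> 'a \<Rightarrow> real" where
  "second_diff h f x = f (x + h) - 2 * f x + f (x - h)"

definition Z_space :: "(real ^ 'n \<Rightarrow> real) set" where
  "Z_space = {f. ess_bounded f \<and>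
     (\<exists>L R. (\<forall>x. L x > 0 \<and> R x > 0) \<and>
            (\<forall>x. \<forall>h\<in>ball 0 (R x). \<bar>second_diff h f x\<bar> \<le> L x * (norm h)\<^sup>2))}"

section \<open>The operators \<open>\<Phi>(-\<Delta>)\<close> and \<open>\<Phi>(-\<Delta>) + V\<close> on \<open>L\<^sup>2\<close>\<close>

text \<open>The \<open>L\<^sup>2\<close> (Plancherel) Fourier transform, as a relation determining the transform up to null
  sets: the \<open>L\<^sup>2\<close> limit of the Fourier integrals over growing balls. The kernel \<open>exp (- i x \<bullet> y)\<close>
  without a factor \<open>2 * pi\<close> makes \<open>-\<Delta>\<close> correspond to the multiplier \<open>(norm y)\<^sup>2\<close>.\<close>

definition fourier_on_ball :: "real \<Rightarrow> (real ^ 'n \<Rightarrow> complex) \<Rightarrow> real ^ 'n \<Rightarrow> complex" where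
  "fourier_on_ball r f y = (2 * pi) powr (- real CARD('n) / 2) *\<^sub>R
     (LINT x:cball 0 r|lebesgue. cis (- (x \<bullet> y)) * f x)"

definition is_fourier_transform :: "(real ^ 'n \<Rightarrow> complex) \<Rightarrow> (real ^ 'n \<Rightarrow> complex) \<Rightarrow> bool" where
  "is_fourier_transform f F \<longleftrightarrow> square_integrable f \<and> square_integrable F \<and>
     (\<lambda>k::nat. \<integral>\<^sup>+y. ennreal ((norm (fourier_on_ball (real k) f y - F y))\<^sup>2) \<partial>lebesgue)
       \<longlonglongrightarrow> 0"

text \<open>Unbounded operators on \<open>L\<^sup>2\<close> are given by their graphs: \<open>phi_laplacian \<Phi> f g\<close> says that \<open>f\<close>
  lies in the domain of \<open>\<Phi>(-\<Delta>)\<close> and \<open>\<Phi>(-\<Delta>) f = g\<close> almost everywhere.\<close>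

definition phi_laplacian ::
    "(real \<Rightarrow> real) \<Rightarrow> (real ^ 'n \<Rightarrow> real) \<Rightarrow> (real ^ 'n \<Rightarrow> real) \<Rightarrow> bool" where
  "phi_laplacian \<Phi> f g \<longleftrightarrow>
     (\<exists>F. is_fourier_transform (\<lambda>x. complex_of_real (f x)) F \<and>
          is_fourier_transform (\<lambda>x. complex_of_real (g x))
            (\<lambda>y. complex_of_real (\<Phi> ((norm y)\<^sup>2)) * F y))"

definition schroedinger_op ::
    "(real \<Rightarrow> real) \<Rightarrow> (real ^ 'n \<Rightarrow> real) \<Rightarrow> (real ^ 'n \<Rightarrow> real) \<Rightarrow> (real ^ 'n \<Rightarrow> real) \<Rightarrow> bool" where
  "schroedinger_op \<Phi> V f g \<longleftrightarrow>
     (\<exists>w. phi_laplacian \<Phi> f w \<and> square_integrable (\<lambda>x. V x * f x) \<and>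
          (AE x in lebesgue. g x = w x + V x * f x))"

section \<open>Symmetries\<close>

definition radially_symmetric :: "('a::real_normed_vector \<Rightarrow> 'b) \<Rightarrow> bool" where
  "radially_symmetric f \<longleftrightarrow> (\<exists>g. \<forall>x. f x = g (norm x))"

definition hyperplane :: "'a::euclidean_space set \<Rightarrow> bool" where
  "hyperplane S \<longleftrightarrow> (\<exists>a b. a \<noteq> 0 \<and> S = {x. a \<bullet> x = b})"

definition reflection_in :: "'a::euclidean_space set \<Rightarrow> 'a \<Rightarrow> 'a" where
  "reflection_in S x = 2 *\<^sub>R closest_point S x - x"

lemma reflection_in_hyperplane:
  assumes "a \<noteq> 0"
  shows "reflection_in {y. a \<bullet> y = 0} x = x - (2 * (a \<bullet> x) / (a \<bullet> a)) *\<^sub>R a"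
proof -
  let ?S = "{y. a \<bullet> y = 0}" and ?p = "x - ((a \<bullet> x) / (a \<bullet> a)) *\<^sub>R a"
  have p: "?p \<in> ?S"
    using assms by (simp add: inner_diff_right)
  have "dist x ?p \<le> dist x z" if "z \<in> ?S" for z
  proof -
    have "\<bar>a \<bullet> x\<bar> \<le> norm a * norm (x - z)"
      using Cauchy_Schwarz_ineq2[of a "x - z"] that by (simp add: inner_diff_right)
    then show ?thesis
      using assms
      by (simp add: dist_norm dot_square_norm power2_eq_square divide_simps mult.commute)
  qed
  then have "?p = closest_point ?S x"
    by (intro closest_point_unique convex_hyperplane closed_hyperplane p) auto
  then have "reflection_in ?S x = 2 *\<^sub>R ?p - x"
    by (simp add: reflection_in_def)
  also have "\<dots> = x - (2 * (a \<bullet> x) / (a \<bullet> a)) *\<^sub>R a"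
    by (simp add: algebra_simps scaleR_2)
  finally show ?thesis .
qed

end

theory Submission
  imports Defs
begin

text \<open>The generator of an isotropic jump process commutes with every orthogonal map \<open>T\<close> of
  \<open>\<real>\<^sup>d\<close>. Indeed, if \<open>\<phi> \<circ> T = \<phi>\<close>, then linearity gives
  \<open>D\<^bsub>T h\<^esub> \<phi> (T x) = D\<^bsub>h\<^esub> \<phi> (x)\<close>, while \<open>j(|T h|) = j(|h|)\<close>; the substitution
  \<open>h \<mapsto> T h\<close>, which preserves Lebesgue measure, therefore turns the integral that defines
  \<open>V (T x)\<close> into the one that defines \<open>V x\<close>. The reflection in a hyperplane through the origin is
  such a map \<open>T\<close>.

  The analytic ingredient is the invariance of Lebesgue measure under orthogonal maps of an
  arbitrary Euclidean space (\<open>distr_lborel_orthogonal\<close>, \<open>distr_lebesgue_orthogonal\<close>). It is derived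
  from translation invariance and the symmetry of the unit ball alone. The substitution rule
  (\<open>integral_lebesgue_orthogonal\<close>) holds for every integrand: the default value \<open>0\<close> of the integral
  of a non-integrable function is invariant as well.\<close>

lemma nn_integral_lborel_translate:
  fixes f :: "'a::euclidean_space \<Rightarrow> ennreal"
  assumes [measurable]: "f \<in> borel_measurable borel"
  shows "(\<integral>\<^sup>+x. f (c + x) \<partial>lborel) = (\<integral>\<^sup>+x. f x \<partial>lborel)"
proof -
  have "(\<integral>\<^sup>+x. f x \<partial>lborel) = (\<integral>\<^sup>+x. f x \<partial>distr lborel borel ((+) c))"
    by (simp add: lborel_distr_plus)
  also have "\<dots> = (\<integral>\<^sup>+x. f (c + x) \<partial>lborel)"
    by (subst nn_integral_distr) auto
  finally show ?thesis by simp
qed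

text \<open>This is the argument for the uniqueness of Haar measure. With \<open>B\<close> the unit ball, the integral
  of \<open>1\<^bsub>A\<^esub> (T x) 1\<^bsub>B\<^esub> (y - T x)\<close> over \<open>x\<close> and \<open>y\<close> is computed in both orders. Translating
  \<open>y\<close> by \<open>T x\<close> gives \<open>|T\<^sup>-\<^sup>1 A| |B|\<close>; translating \<open>x\<close> by \<open>T\<^sup>-\<^sup>1 y\<close> gives
  \<open>|A| |B|\<close>, because \<open>- T x \<in> B\<close> exactly when \<open>x \<in> B\<close>. Finally \<open>0 < |B| < \<infinity>\<close> cancels.\<close>

lemma distr_lborel_orthogonal:
  fixes T :: "'a::euclidean_space \<Rightarrow> 'a"
  assumes T: "orthogonal_transformation T"
  shows "distr lborel borel T = lborel"
proof (rule measure_eqI)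
  show "sets (distr lborel borel T) = sets (lborel :: 'a measure)" by simp
next
  fix A :: "'a set" assume "A \<in> sets (distr lborel borel T)"
  then have A[measurable]: "A \<in> sets borel" by simp
  have lin: "linear T" using T by (rule orthogonal_transformation_linear)
  have T_meas[measurable]: "T \<in> borel_measurable borel"
    using lin by (simp add: borel_measurable_continuous_onI linear_continuous_on linear_linear)
  define B :: "'a set" where "B = ball 0 1"
  have B[measurable]: "B \<in> sets borel" by (simp add: B_def)
  have "unit_ball_vol (real DIM('a)) \<noteq> 0"
    using unit_ball_vol_pos[of "real DIM('a)"] by linarith
  then have B_pos: "emeasure lborel B \<noteq> 0" and B_fin: "emeasure lborel B \<noteq> \<infinity>"
    using emeasure_ball[of 1 "0::'a"] by (auto simp: B_def)
  have B_sym: "- T x \<in> B \<longleftrightarrow> x \<in> B" for x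
    by (simp add: B_def orthogonal_transformation_norm[OF T])
  define F :: "'a \<Rightarrow> 'a \<Rightarrow> ennreal"
    where "F x y = indicator A (T x) * indicator B (y - T x)" for x y
  have "(\<integral>\<^sup>+x. \<integral>\<^sup>+y. F x y \<partial>lborel \<partial>lborel) = (\<integral>\<^sup>+x. indicator A (T x) * emeasure lborel B \<partial>lborel)"
  proof (rule nn_integral_cong)
    fix x
    have "(\<integral>\<^sup>+y. F x y \<partial>lborel)
        = indicator A (T x) * (\<integral>\<^sup>+y. indicator B (- T x + y) \<partial>lborel)"
      unfolding F_def by (subst nn_integral_cmult[symmetric]) simp_all
    also have "(\<integral>\<^sup>+y. indicator B (- T x + y) \<partial>lborel) = (\<integral>\<^sup>+y. indicator B y \<partial>lborel)"
      by (rule nn_integral_lborel_translate) measurable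
    finally show "(\<integral>\<^sup>+y. F x y \<partial>lborel) = indicator A (T x) * emeasure lborel B" by simp
  qed
  also have "\<dots> = emeasure (distr lborel borel T) A * emeasure lborel B"
  proof -
    have "emeasure (distr lborel borel T) A = (\<integral>\<^sup>+x. indicator A x \<partial>distr lborel borel T)"
      by simp
    also have "\<dots> = (\<integral>\<^sup>+x. indicator A (T x) \<partial>lborel)"
      by (rule nn_integral_distr) auto
    finally show ?thesis by (simp add: nn_integral_multc)
  qed
  finally have eq1: "(\<integral>\<^sup>+x. \<integral>\<^sup>+y. F x y \<partial>lborel \<partial>lborel)
      = emeasure (distr lborel borel T) A * emeasure lborel B" .
  have inner: "(\<integral>\<^sup>+x. F x y \<partial>lborel) = (\<integral>\<^sup>+x. indicator A (T x + y) * indicator B x \<partial>lborel)" for y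
  proof -
    obtain z where z: "y = T z"
      using orthogonal_transformation_surj[OF T] by (metis surjD)
    have "(\<integral>\<^sup>+x. F x y \<partial>lborel) = (\<integral>\<^sup>+x. F (z + x) y \<partial>lborel)"
      unfolding F_def by (rule nn_integral_lborel_translate[symmetric]) measurable
    also have "\<dots> = (\<integral>\<^sup>+x. indicator A (T x + y) * indicator B x \<partial>lborel)"
    proof (rule nn_integral_cong)
      fix x
      show "F (z + x) y = indicator A (T x + y) * indicator B x"
        using B_sym[of x] by (simp add: F_def z linear_add[OF lin] add.commute indicator_def)
    qed
    finally show ?thesis by simp
  qed
  have "(\<integral>\<^sup>+x. \<integral>\<^sup>+y. F x y \<partial>lborel \<partial>lborel) = (\<integral>\<^sup>+y. \<integral>\<^sup>+x. F x y \<partial>lborel \<partial>lborel)"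
    unfolding F_def by (rule lborel_pair.Fubini'[symmetric]) measurable
  also have "\<dots> = (\<integral>\<^sup>+y. \<integral>\<^sup>+x. indicator A (T x + y) * indicator B x \<partial>lborel \<partial>lborel)"
    by (simp add: inner)
  also have "\<dots> = (\<integral>\<^sup>+x. \<integral>\<^sup>+y. indicator A (T x + y) * indicator B x \<partial>lborel \<partial>lborel)"
    by (rule lborel_pair.Fubini') measurable
  also have "\<dots> = (\<integral>\<^sup>+x. emeasure lborel A * indicator B x \<partial>lborel)"
  proof (rule nn_integral_cong)
    fix x
    have "(\<integral>\<^sup>+y. indicator A (T x + y) * indicator B x \<partial>lborel)
        = (\<integral>\<^sup>+y. indicator A (T x + y) \<partial>lborel) * indicator B x"
      by (rule nn_integral_multc) measurable
    also have "(\<integral>\<^sup>+y. indicator A (T x + y) \<partial>lborel) = (\<integral>\<^sup>+y. indicator A y \<partial>lborel)"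
      by (rule nn_integral_lborel_translate) measurable
    finally show "(\<integral>\<^sup>+y. indicator A (T x + y) * indicator B x \<partial>lborel)
        = emeasure lborel A * indicator B x" by simp
  qed
  also have "\<dots> = emeasure lborel A * emeasure lborel B"
    by (simp add: nn_integral_cmult)
  finally have "emeasure (distr lborel borel T) A * emeasure lborel B
      = emeasure lborel A * emeasure lborel B"
    using eq1 by simp
  then show "emeasure (distr lborel borel T) A = emeasure lborel A"
    using B_pos B_fin by (simp add: ennreal_mult_cancel_left mult.commute[of _ "emeasure lborel B"])
qed

lemma
  fixes T :: "'a::euclidean_space \<Rightarrow> 'a"
  assumes T: "orthogonal_transformation T"
  shows measurable_lebesgue_orthogonal: "T \<in> lebesgue \<rightarrow>\<^sub>M lebesgue"
    and distr_lebesgue_orthogonal: "distr lebesgue lebesgue T = lebesgue"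
proof -
  have T_meas[measurable]: "T \<in> borel_measurable borel"
    using orthogonal_transformation_linear[OF T]
    by (simp add: borel_measurable_continuous_onI linear_continuous_on linear_linear)
  have distr: "distr lebesgue lborel T = lborel"
  proof -
    have "distr lebesgue lborel T = distr lborel lborel T"
      by (rule distr_completion) simp
    also have "\<dots> = distr lborel borel T"
      by (rule distr_cong) simp_all
    finally show ?thesis by (simp add: distr_lborel_orthogonal[OF T])
  qed
  have T_lebesgue: "T \<in> lebesgue \<rightarrow>\<^sub>M lborel"
    by (simp add: measurable_completion)
  show "T \<in> lebesgue \<rightarrow>\<^sub>M lebesgue"
    by (rule completion.measurable_completion2[OF T_lebesgue]) (simp add: distr)
  have "completion (distr lebesgue lborel T) = distr lebesgue lebesgue T"
    by (rule completion.completion_distr_eq[OF T_lebesgue]) (simp add: distr)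
  then show "distr lebesgue lebesgue T = lebesgue"
    by (simp add: distr)
qed

text \<open>Applying the substitution to \<open>T\<^sup>-\<^sup>1\<close> as well shows that \<open>f \<circ> T\<close> is integrable only if \<open>f\<close>
  is, so that in the remaining case both sides have the default value \<open>0\<close>.\<close>

lemma integral_lebesgue_orthogonal:
  fixes T :: "'a::euclidean_space \<Rightarrow> 'a" and f :: "'a \<Rightarrow> 'b::{banach, second_countable_topology}"
  assumes T: "orthogonal_transformation T"
  shows "(LINT x|lebesgue. f (T x)) = (LINT x|lebesgue. f x)"
proof -
  have subst: "integrable lebesgue (\<lambda>x. g (S x))"
    if S: "orthogonal_transformation S" and g: "integrable lebesgue g"
    for S :: "'a \<Rightarrow> 'a" and g :: "'a \<Rightarrow> 'b"
    using g integrable_distr[OF measurable_lebesgue_orthogonal[OF S], of g]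
    by (simp add: distr_lebesgue_orthogonal[OF S])
  show ?thesis
  proof (cases "integrable lebesgue f")
    case True
    then show ?thesis
      using integral_distr[OF measurable_lebesgue_orthogonal[OF T], of f]
      by (simp add: distr_lebesgue_orthogonal[OF T])
  next
    case False
    have "\<not> integrable lebesgue (\<lambda>x. f (T x))"
    proof
      assume "integrable lebesgue (\<lambda>x. f (T x))"
      then have "integrable lebesgue (\<lambda>x. f (T (inv T x)))"
        by (rule subst[OF orthogonal_transformation_inv[OF T]])
      with False show False
        by (simp add: surj_f_inv_f[OF orthogonal_transformation_surj[OF T]])
    qed
    with False show ?thesis
      by (simp add: not_integrable_integral_eq)
  qed
qed

lemma integral_second_diff_orthogonal:
  fixes T :: "'a::euclidean_space \<Rightarrow> 'a" and f :: "'a \<Rightarrow> real" and k :: "real \<Rightarrow> real"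
  assumes T: "orthogonal_transformation T" and inv: "\<And>x. f (T x) = f x"
  shows "(LINT h|lebesgue. second_diff h f (T x) * k (norm h))
       = (LINT h|lebesgue. second_diff h f x * k (norm h))"
proof -
  have lin: "linear T" using T by (rule orthogonal_transformation_linear)
  have "second_diff (T h) f (T x) = second_diff h f x" for h
    using inv[of "x + h"] inv[of "x - h"] inv[of x]
    by (simp add: second_diff_def linear_add[OF lin] linear_diff[OF lin])
  then show ?thesis
    using integral_lebesgue_orthogonal[OF T, of "\<lambda>h. second_diff h f (T x) * k (norm h)"]
    by (simp add: orthogonal_transformation_norm[OF T])
qed

lemma orthogonal_transformation_reflection_in:
  assumes "hyperplane S" and "0 \<in> S"
  shows "orthogonal_transformation (reflection_in S)"
proof -
  obtain a where a: "a \<noteq> 0" and S: "S = {x. a \<bullet> x = 0}"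
    using assms by (auto simp: hyperplane_def)
  have refl: "reflection_in S = (\<lambda>x. x - (2 * (a \<bullet> x) / (a \<bullet> a)) *\<^sub>R a)"
    using reflection_in_hyperplane[OF a] by (auto simp: S)
  have "linear (reflection_in S)"
    unfolding refl by (rule linearI) (simp_all add: inner_add_right algebra_simps add_divide_distrib)
  moreover have "reflection_in S v \<bullet> reflection_in S w = v \<bullet> w" for v w
    using a unfolding refl
    by (simp add: inner_diff_left inner_diff_right inner_commute field_simps)
  ultimately show ?thesis
    by (simp add: orthogonal_transformation_def)
qed

theorem theorem7p2:
  fixes \<Phi> \<mu> :: "real \<Rightarrow> real"
    and \<phi> V :: "real ^ 'n \<Rightarrow> real"
    and \<pi> :: "(real ^ 'n) set"
  assumes "complete_bernstein \<Phi> \<mu>"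
    and "square_integrable \<phi>" and "ess_bounded \<phi>" and "\<forall>x. \<phi> x > 0"
    and "schroedinger_op \<Phi> V \<phi> (\<lambda>x. 0)"
    and "\<forall>x. V x = 1 / (2 * \<phi> x) *
           (LINT h|lebesgue. second_diff h \<phi> x * jump_kernel CARD('n) \<mu> (norm h))"
    and "\<phi> \<in> Z_space"
    and "radially_symmetric \<phi>"
    and "hyperplane \<pi>" and "0 \<in> \<pi>"
    and "\<forall>x. \<phi> (reflection_in \<pi> x) = \<phi> x"
  shows "\<forall>x. V (reflection_in \<pi> x) = V x"
proof
  fix x
  have "(LINT h|lebesgue. second_diff h \<phi> (reflection_in \<pi> x) * jump_kernel CARD('n) \<mu> (norm h))
      = (LINT h|lebesgue. second_diff h \<phi> x * jump_kernel CARD('n) \<mu> (norm h))"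
    using assms(9-11)
    by (intro integral_second_diff_orthogonal orthogonal_transformation_reflection_in) auto
  with assms(6,11) show "V (reflection_in \<pi> x) = V x"
    by simp
qed

end
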